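(* Let $(X,d_X)$ and $(Y,d_Y)$ be compact geodesic spaces, and let $f: X \to \mathbb{R}$, $g: Y \to \mathbb{R}$ be $1$-Lipschitz functions. Then $$d_{\mathrm{GH}}(T_f,T_g) \leq 12\, d_{\mathrm{GH}}((X,f),(Y,g)).$$
   Context: Geodesic space: a metric space in which any two points are joined by a path whose length equals their distance. For a compact connected topological space $X$ and continuous $f:X\to\mathbb{R}$, the merge function is $$m_f(x,x'):=\inf\{\sup(f|_A): A\subseteq X,\ x,x'\in A,\ A \text{ connected}\},$$ and $\mathrm{t}_f(x,x'):=2m_f(x,x')-f(x)-f(x')$ is a pseudometric on $X$. The merge metric tree $(T_f,\mathrm{t}_f)$ is the metric space obtained from $X$ by identifying points at $\mathrm{t}_f$-distance $0$. A correspondence $R$ between sets $X$ and $Y$ is a subset of $X\times Y$ projecting onto both $X$ and $Y$. For metric spaces, $\mathrm{dis}(R):=\sup_{(x,y),(x',y')\in R}|d_X(x,x')-d_Y(y,y')|$, and $d_{\mathrm{GH}}(X,Y):=\frac12\inf_R \mathrm{dis}(R)$ over all correspondences. With functions $f:X\to\mathbb{R}$, $g:Y\to\mathbb{R}$, put $\mathrm{dis}_{f,g}(R):=\max\bigl(\mathrm{dis}(R),\sup_{(x,y)\in R}|f(x)-g(y)|\bigr)$ and $d_{\mathrm{GH}}((X,f),(Y,g)):=\frac12\inf_R\mathrm{dis}_{f,g}(R)$ over all correspondences $R$ between $X$ and $Y$. *)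

theory Defs
  imports "HOL-Analysis.Analysis"
begin

text \<open>The length of a path on \<open>[0, 1]\<close> is the supremum over all subdivisions
  \<open>0 = t 0 \<le> \<dots> \<le> t n = 1\<close>, possibly infinite.\<close>

definition path_length :: "('a \<Rightarrow> 'a \<Rightarrow> real) \<Rightarrow> (real \<Rightarrow> 'a) \<Rightarrow> ennreal" where
  "path_length d p =
     (SUP (n, t) \<in> {(n, t :: nat \<Rightarrow> real). t 0 = 0 \<and> t n = 1 \<and> mono_on {..n} t}.
        \<Sum>i<n. ennreal (d (p (t i)) (p (t (Suc i)))))"

definition geodesic_space :: "'a set \<Rightarrow> ('a \<Rightarrow> 'a \<Rightarrow> real) \<Rightarrow> bool" where
  "geodesic_space M d \<longleftrightarrow> Metric_space M d \<and>
     (\<forall>x\<in>M. \<forall>y\<in>M. \<exists>p. pathin (Metric_space.mtopology M d) p \<and> p 0 = x \<and> p 1 = y \<and>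
        path_length d p = ennreal (d x y))"

text \<open>The infimum and suprema below are taken in \<open>real\<close>. They have their intended values when
  \<open>X\<close> is compact and connected, \<open>f\<close> is continuous on \<open>X\<close>, and \<open>x\<close>, \<open>x'\<close> lie in \<open>X\<close>.\<close>

definition merge_fun :: "'a topology \<Rightarrow> ('a \<Rightarrow> real) \<Rightarrow> 'a \<Rightarrow> 'a \<Rightarrow> real" where
  "merge_fun X f x x' = (INF A\<in>{A. connectedin X A \<and> x \<in> A \<and> x' \<in> A}. SUP a\<in>A. f a)"

definition merge_pdist :: "'a topology \<Rightarrow> ('a \<Rightarrow> real) \<Rightarrow> 'a \<Rightarrow> 'a \<Rightarrow> real" where
  "merge_pdist X f x x' = 2 * merge_fun X f x x' - f x - f x'"

definition merge_tree :: "'a topology \<Rightarrow> ('a \<Rightarrow> real) \<Rightarrow> 'a set set" where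
  "merge_tree X f =
     topspace X // {(x, x'). x \<in> topspace X \<and> x' \<in> topspace X \<and> merge_pdist X f x x' = 0}"

text \<open>The distance of two classes does not depend on the chosen representatives, since
  \<^const>\<open>merge_pdist\<close> is a pseudometric under the conditions above.\<close>

definition merge_tree_dist :: "'a topology \<Rightarrow> ('a \<Rightarrow> real) \<Rightarrow> 'a set \<Rightarrow> 'a set \<Rightarrow> real" where
  "merge_tree_dist X f A B = merge_pdist X f (SOME a. a \<in> A) (SOME b. b \<in> B)"

definition correspondence :: "'a set \<Rightarrow> 'b set \<Rightarrow> ('a \<times> 'b) set \<Rightarrow> bool" where
  "correspondence M N R \<longleftrightarrow> R \<subseteq> M \<times> N \<and> fst ` R = M \<and> snd ` R = N"

text \<open>Distortions and Gromov--Hausdorff distances take values in \<open>ennreal\<close>, so that suprema over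
  unbounded sets and infima over the empty set are \<open>\<infinity>\<close>.\<close>

definition distortion ::
  "('a \<Rightarrow> 'a \<Rightarrow> real) \<Rightarrow> ('b \<Rightarrow> 'b \<Rightarrow> real) \<Rightarrow> ('a \<times> 'b) set \<Rightarrow> ennreal" where
  "distortion d e R = (SUP ((x, y), (x', y')) \<in> R \<times> R. ennreal \<bar>d x x' - e y y'\<bar>)"

definition fun_distortion ::
  "('a \<Rightarrow> 'a \<Rightarrow> real) \<Rightarrow> ('a \<Rightarrow> real) \<Rightarrow> ('b \<Rightarrow> 'b \<Rightarrow> real) \<Rightarrow> ('b \<Rightarrow> real) \<Rightarrow>
   ('a \<times> 'b) set \<Rightarrow> ennreal" where
  "fun_distortion d f e g R =
     max (distortion d e R) (SUP (x, y) \<in> R. ennreal \<bar>f x - g y\<bar>)"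

definition GH_dist ::
  "'a set \<Rightarrow> ('a \<Rightarrow> 'a \<Rightarrow> real) \<Rightarrow> 'b set \<Rightarrow> ('b \<Rightarrow> 'b \<Rightarrow> real) \<Rightarrow> ennreal" where
  "GH_dist M d N e = (INF R\<in>{R. correspondence M N R}. distortion d e R) / 2"

definition GH_fun_dist ::
  "'a set \<Rightarrow> ('a \<Rightarrow> 'a \<Rightarrow> real) \<Rightarrow> ('a \<Rightarrow> real) \<Rightarrow>
   'b set \<Rightarrow> ('b \<Rightarrow> 'b \<Rightarrow> real) \<Rightarrow> ('b \<Rightarrow> real) \<Rightarrow> ennreal" where
  "GH_fun_dist M d f N e g = (INF R\<in>{R. correspondence M N R}. fun_distortion d f e g R) / 2"

end

theory Submission
  imports Defs
begin

text \<open>A correspondence \<open>R\<close> between \<open>X\<close> and \<open>Y\<close> of distortion at most \<open>r\<close> (for the metrics as well as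
  the functions) induces the correspondence between \<open>T\<^sub>f\<close> and \<open>T\<^sub>g\<close> that relates the class of \<open>x\<close> to
  the class of \<open>y\<close> whenever \<open>(x, y) \<in> R\<close>. The point is that its distortion is at most \<open>6 r\<close>, and
  since \<open>t\<^sub>f(x, x') = 2 m\<^sub>f(x, x') - f x - f x'\<close> and partners differ in function value by at most
  \<open>r\<close>, this follows from \<open>m\<^sub>g(y, y') \<le> m\<^sub>f(x, x') + 2 r\<close> and its mirror image.

  To prove it, let \<open>A\<close> be a connected set containing \<open>x\<close> and \<open>x'\<close> on which \<open>f \<le> s\<close>. For every
  \<open>\<epsilon> > 0\<close>, the points \<open>x\<close> and \<open>x'\<close> are joined by a chain in \<open>A\<close> with steps shorter than \<open>\<epsilon>\<close>.
  Partners in \<open>Y\<close> of its points form a chain from \<open>y\<close> to \<open>y'\<close> with steps shorter than \<open>r + \<epsilon>\<close> on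
  which \<open>g \<le> s + r\<close>. Geodesics filling the gaps produce a connected set on which
  \<open>g \<le> s + 2 r + \<epsilon>\<close>, because \<open>g\<close> is 1-Lipschitz. Two facts turn this into a short argument: \<open>m\<^sub>g\<close>
  satisfies the ultrametric inequality (\<open>merge_fun_ultra\<close>), so that geodesics need not be glued
  explicitly, and \<open>m\<^sub>g(b, b') \<le> g b + d(b, b')\<close> (\<open>merge_fun_le_dist\<close>).\<close>

section \<open>Connected sets and the merge function\<close>

text \<open>The two assumptions make the infimum and the suprema in the merge function meaningful. Since
  \<open>f\<close> is bounded above, each supremum is real, and it is at least \<open>f x\<close> because \<open>x\<close> lies in every
  competing set. Connectedness makes the whole space a competing set.\<close>

locale merge_space =
  fixes T :: "'a topology" and f :: "'a \<Rightarrow> real"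
  assumes connected: "connected_space T"
    and bdd_above: "bdd_above (f ` topspace T)"
begin

lemma bdd_above_on_connectedin: "connectedin T A \<Longrightarrow> bdd_above (f ` A)"
  by (rule bdd_above_mono[OF bdd_above image_mono[OF connectedin_subset_topspace]])

lemma bdd_below_sups: "bdd_below ((\<lambda>A. SUP a\<in>A. f a) ` {A. connectedin T A \<and> x \<in> A \<and> x' \<in> A})"
  by (rule bdd_belowI2[where m = "f x"]) (auto intro: cSUP_upper bdd_above_on_connectedin)

lemma merge_fun_le:
  assumes "connectedin T A" "x \<in> A" "x' \<in> A" "\<And>a. a \<in> A \<Longrightarrow> f a \<le> s"
  shows "merge_fun T f x x' \<le> s"
  unfolding merge_fun_def
proof (rule cINF_lower2[OF bdd_below_sups])
  show "(SUP a\<in>A. f a) \<le> s"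
    using assms by (intro cSUP_least) auto
qed (use assms in auto)

lemma merge_fun_witness:
  assumes "x \<in> topspace T" "x' \<in> topspace T" "merge_fun T f x x' < s"
  obtains A where "connectedin T A" "x \<in> A" "x' \<in> A" "\<And>a. a \<in> A \<Longrightarrow> f a < s"
proof -
  have "topspace T \<in> {A. connectedin T A \<and> x \<in> A \<and> x' \<in> A}"
    using assms connected by (auto simp: connectedin_topspace)
  then obtain A where A: "connectedin T A" "x \<in> A" "x' \<in> A" "(SUP a\<in>A. f a) < s"
    using assms(3) cINF_less_iff[OF _ bdd_below_sups] unfolding merge_fun_def by blast
  then show thesis
    by (meson that bdd_above_on_connectedin cSUP_upper le_less_trans)
qed

lemma merge_fun_commute: "merge_fun T f x x' = merge_fun T f x' x"
  unfolding merge_fun_def by (rule arg_cong[where f = Inf]) auto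

lemma merge_fun_ge:
  assumes "x \<in> topspace T" "x' \<in> topspace T"
  shows "f x \<le> merge_fun T f x x'"
proof (rule dense_ge)
  fix s assume "merge_fun T f x x' < s"
  then obtain A where "x \<in> A" "\<And>a. a \<in> A \<Longrightarrow> f a < s"
    using merge_fun_witness[OF assms] by metis
  then show "f x \<le> s"
    by (simp add: less_imp_le)
qed

lemma merge_fun_refl: "x \<in> topspace T \<Longrightarrow> merge_fun T f x x = f x"
  by (intro antisym merge_fun_ge merge_fun_le[of "{x}"]) auto

text \<open>If \<open>A\<close> joins \<open>x\<close> to \<open>y\<close> and \<open>B\<close> joins \<open>y\<close> to \<open>z\<close>, both below the level \<open>s\<close>, then so does
  \<open>A \<union> B\<close> for \<open>x\<close> and \<open>z\<close>.\<close>

lemma merge_fun_ultra: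
  assumes "x \<in> topspace T" "y \<in> topspace T" "z \<in> topspace T"
  shows "merge_fun T f x z \<le> max (merge_fun T f x y) (merge_fun T f y z)"
proof (rule dense_ge)
  fix s assume s: "max (merge_fun T f x y) (merge_fun T f y z) < s"
  obtain A where A: "connectedin T A" "x \<in> A" "y \<in> A" "\<And>a. a \<in> A \<Longrightarrow> f a < s"
    using merge_fun_witness[of x y s] assms s by auto
  obtain B where B: "connectedin T B" "y \<in> B" "z \<in> B" "\<And>a. a \<in> B \<Longrightarrow> f a < s"
    using merge_fun_witness[of y z s] assms s by auto
  have "connectedin T (A \<union> B)"
    using A B by (intro connectedin_Un) auto
  then show "merge_fun T f x z \<le> s"
    using A B by (intro merge_fun_le[of "A \<union> B"]) (auto intro: less_imp_le)
qed

section \<open>The merge metric tree\<close>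

lemma merge_pdist_commute: "merge_pdist T f x y = merge_pdist T f y x"
  unfolding merge_pdist_def using merge_fun_commute[of x y] by simp

text \<open>The ultrametric inequality bounds \<open>m(x, z)\<close> by the larger of \<open>m(x, y)\<close> and \<open>m(y, z)\<close>; the
  smaller one still exceeds \<open>f y\<close>, which pays for the two copies of \<open>f y\<close> on the right-hand side.\<close>

lemma merge_pdist_triangle:
  assumes "x \<in> topspace T" "y \<in> topspace T" "z \<in> topspace T"
  shows "merge_pdist T f x z \<le> merge_pdist T f x y + merge_pdist T f y z"
  using merge_fun_ultra[OF assms] merge_fun_ge[of y x] merge_fun_ge[of y z]
    merge_fun_commute[of x y] assms
  unfolding merge_pdist_def by auto

definition merge_class :: "'a \<Rightarrow> 'a set" where
  "merge_class x =
     {(x, x'). x \<in> topspace T \<and> x' \<in> topspace T \<and> merge_pdist T f x x' = 0} `` {x}"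

lemma merge_tree_eq: "merge_tree T f = merge_class ` topspace T"
  unfolding merge_tree_def quotient_def merge_class_def by auto

lemma merge_class_representative:
  assumes "x \<in> topspace T"
  defines "a \<equiv> (SOME a. a \<in> merge_class x)"
  shows "a \<in> topspace T \<and> merge_pdist T f x a = 0"
proof -
  have "x \<in> merge_class x"
    using assms by (simp add: merge_class_def merge_pdist_def merge_fun_refl)
  then have "a \<in> merge_class x"
    unfolding a_def by (rule someI)
  then show ?thesis
    by (simp add: merge_class_def)
qed

lemma merge_tree_dist_class:
  assumes x: "x \<in> topspace T" and y: "y \<in> topspace T"
  shows "merge_tree_dist T f (merge_class x) (merge_class y) = merge_pdist T f x y"
proof -
  define a where "a = (SOME a. a \<in> merge_class x)"
  define b where "b = (SOME b. b \<in> merge_class y)"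
  have a: "a \<in> topspace T" "merge_pdist T f x a = 0"
    using merge_class_representative[OF x] unfolding a_def by auto
  have b: "b \<in> topspace T" "merge_pdist T f y b = 0"
    using merge_class_representative[OF y] unfolding b_def by auto
  have "merge_pdist T f a b = merge_pdist T f x y"
    using merge_pdist_triangle[of a x b] merge_pdist_triangle[of x y b]
      merge_pdist_triangle[of x a y] merge_pdist_triangle[of a b y]
      merge_pdist_commute[of a x] merge_pdist_commute[of b y] a b x y by linarith
  then show ?thesis
    by (simp add: merge_tree_dist_def a_def b_def)
qed

end

section \<open>Lipschitz functions on compact geodesic spaces\<close>

text \<open>Consequently a geodesic from \<open>x\<close> to \<open>y\<close> stays within distance \<open>d x y\<close> of \<open>x\<close>.\<close>

lemma dist_le_path_length:
  assumes u: "u \<in> {0..1}"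
  shows "ennreal (d (p 0) (p u)) \<le> path_length d p"
proof -
  \<comment> \<open>The subdivision \<open>0 \<le> u \<le> 1\<close>.\<close>
  define t :: "nat \<Rightarrow> real" where "t i = (if i = 0 then 0 else if i = 1 then u else 1)" for i
  have t: "t 0 = 0" "t 1 = u" "t 2 = 1" "mono_on {..2} t"
    using u by (auto simp: t_def mono_on_def)
  have "(\<Sum>i<2. ennreal (d (p (t i)) (p (t (Suc i))))) \<le> path_length d p"
    unfolding path_length_def by (rule SUP_upper2[where i = "(2, t)"]) (use t in auto)
  then have "ennreal (d (p 0) (p u)) + ennreal (d (p u) (p 1)) \<le> path_length d p"
    using t by (simp add: numeral_2_eq_2)
  then show ?thesis
    by (rule order_trans[rotated]) simp
qed

locale lipschitz_geodesic = Metric_space M d for M :: "'a set" and d +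
  fixes f :: "'a \<Rightarrow> real"
  assumes geodesic: "geodesic_space M d"
    and compact: "compact_space mtopology"
    and lipschitz: "\<forall>x\<in>M. \<forall>x'\<in>M. \<bar>f x - f x'\<bar> \<le> d x x'"
begin

lemma obtain_geodesic:
  assumes "x \<in> M" "y \<in> M"
  obtains p where "pathin mtopology p" "p 0 = x" "p 1 = y"
    "\<And>u. u \<in> {0..1} \<Longrightarrow> p u \<in> M \<and> d x (p u) \<le> d x y"
proof -
  obtain p where p: "pathin mtopology p" "p 0 = x" "p 1 = y" "path_length d p = ennreal (d x y)"
    using geodesic assms unfolding geodesic_space_def by blast
  have "p u \<in> M \<and> d x (p u) \<le> d x y" if "u \<in> {0..1}" for u
    using path_image_subset_topspace[OF p(1)] dist_le_path_length[OF that, of d p] p that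
    by (auto simp: ennreal_le_iff)
  with p show thesis
    using that by blast
qed

sublocale merge_space mtopology f
proof
  have "path_connected_space mtopology"
    unfolding path_connected_space_def by (metis obtain_geodesic topspace_mtopology)
  then show "connected_space mtopology"
    by (rule path_connected_imp_connected_space)
  have "mbounded M"
    using compact compactin_imp_mbounded by (metis compact_space_def topspace_mtopology)
  then obtain c B where "M \<subseteq> mcball c B"
    unfolding mbounded_def by blast
  then have "f x \<le> f c + B" if "x \<in> M" for x
    using that lipschitz by (force simp: commute)
  then show "bdd_above (f ` topspace mtopology)"
    by (intro bdd_aboveI2[where M = "f c + B"]) auto
qed

text \<open>The competing connected set is a geodesic. Along it, a 1-Lipschitz function rises above
  \<open>f x\<close> by at most \<open>d x y\<close>.\<close>

lemma merge_fun_le_dist: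
  assumes "x \<in> M" "y \<in> M"
  shows "merge_fun mtopology f x y \<le> f x + d x y"
proof -
  obtain p where p: "pathin mtopology p" "p 0 = x" "p 1 = y"
    "\<And>u. u \<in> {0..1} \<Longrightarrow> p u \<in> M \<and> d x (p u) \<le> d x y"
    using obtain_geodesic[OF assms] by blast
  show ?thesis
  proof (rule merge_fun_le[of "p ` {0..1}"])
    show "connectedin mtopology (p ` {0..1})"
      using p(1) by (rule connectedin_path_image)
    show "x \<in> p ` {0..1}" "y \<in> p ` {0..1}"
      using p by force+
    show "f a \<le> f x + d x y" if "a \<in> p ` {0..1}" for a
    proof -
      have "a \<in> M" "d x a \<le> d x y"
        using p that by auto
      then show ?thesis
        using lipschitz assms by (smt (verit))
    qed
  qed
qed

end

section \<open>Correspondences and merge functions\<close>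

text \<open>Induction along chains in \<open>A\<close> with steps shorter than \<open>\<epsilon>\<close>. It is valid because if \<open>P\<close> failed somewhere on \<open>A\<close>, the
  \<open>\<epsilon>\<close>-neighbourhoods of the points of \<open>A\<close> with and without \<open>P\<close> would disconnect \<open>A\<close>.\<close>

lemma (in Metric_space) connectedin_chain_induct:
  assumes A: "connectedin mtopology A" and x: "x \<in> A" "P x" and "x' \<in> A" and "\<epsilon> > 0"
    and step: "\<And>a b. a \<in> A \<Longrightarrow> b \<in> A \<Longrightarrow> d a b < \<epsilon> \<Longrightarrow> P a \<Longrightarrow> P b"
  shows "P x'"
proof (rule ccontr)
  assume "\<not> P x'"
  have AM: "A \<subseteq> M"
    using connectedin_subset_topspace[OF A] by simp
  define U where "U Q = (\<Union>a\<in>{a\<in>A. Q a}. mball a \<epsilon>)" for Q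
  have U: "a \<in> U Q" if "a \<in> A" "Q a" for a Q
    using that AM \<open>\<epsilon> > 0\<close> unfolding U_def by (intro UN_I[of a]) auto
  have "openin mtopology (U Q)" for Q
    unfolding U_def by auto
  moreover have "U P \<inter> U (\<lambda>a. \<not> P a) \<inter> A = {}"
  proof -
    have False if "c \<in> A" "a \<in> A" "P a" "d a c < \<epsilon>" "b \<in> A" "\<not> P b" "d b c < \<epsilon>" for a b c
      using step[of a c] step[of c b] that by (simp add: commute)
    then show ?thesis
      by (auto simp: U_def)
  qed
  moreover have "A \<subseteq> U P \<union> U (\<lambda>a. \<not> P a)"
    using U[of _ P] U[of _ "\<lambda>a. \<not> P a"] by blast
  moreover have "U P \<inter> A \<noteq> {}" "U (\<lambda>a. \<not> P a) \<inter> A \<noteq> {}"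
    using U[of x P] U[of x' "\<lambda>a. \<not> P a"] x \<open>x' \<in> A\<close> \<open>\<not> P x'\<close> by blast+
  ultimately show False
    using A unfolding connectedin by metis
qed

text \<open>The heart of the proof. The slack \<open>2 r\<close> has two sources: partners of points of \<open>A\<close> may lie
  higher than these by \<open>r\<close>, and partners of points at distance less than \<open>\<epsilon>\<close> may be almost
  \<open>r + \<epsilon>\<close> apart, so that a geodesic between them rises by as much. This is one half of a
  symmetric estimate; the other half is the same lemma for the converse correspondence.\<close>

lemma merge_fun_correspondence_le:
  assumes "lipschitz_geodesic X dX f" "lipschitz_geodesic Y dY g"
    and R: "correspondence X Y R"
    and dist: "\<And>x y x' y'. (x, y) \<in> R \<Longrightarrow> (x', y') \<in> R \<Longrightarrow> \<bar>dX x x' - dY y y'\<bar> \<le> r"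
    and fun_dist: "\<And>x y. (x, y) \<in> R \<Longrightarrow> \<bar>f x - g y\<bar> \<le> r"
    and xy: "(x, y) \<in> R" "(x', y') \<in> R"
  shows "merge_fun (Metric_space.mtopology Y dY) g y y'
    \<le> merge_fun (Metric_space.mtopology X dX) f x x' + 2 * r"
proof -
  interpret X: lipschitz_geodesic X dX f by fact
  interpret Y: lipschitz_geodesic Y dY g by fact
  let ?mg = "merge_fun Y.mtopology g"
  have mem: "a \<in> X" "b \<in> Y" if "(a, b) \<in> R" for a b
    using R that by (auto simp: correspondence_def)
  have partner: "\<exists>b. (a, b) \<in> R" if "a \<in> X" for a
    using R that by (force simp: correspondence_def)
  have "?mg y y' \<le> merge_fun X.mtopology f x x' + 2 * r + e" if "e > 0" for e
  proof -
    \<comment> \<open>Half of \<open>e\<close> goes into the choice of \<open>A\<close>, the other half into the steps of the chain.\<close>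
    define \<epsilon> where "\<epsilon> = e / 2"
    have "\<epsilon> > 0"
      using that by (simp add: \<epsilon>_def)
    define s where "s = merge_fun X.mtopology f x x' + \<epsilon>"
    obtain A where A: "connectedin X.mtopology A" "x \<in> A" "x' \<in> A" "\<And>a. a \<in> A \<Longrightarrow> f a < s"
      using X.merge_fun_witness[of x x' s] mem xy \<open>\<epsilon> > 0\<close> by (auto simp: s_def)
    have AX: "A \<subseteq> X"
      using connectedin_subset_topspace[OF A(1)] by simp
    have near: "?mg b b' \<le> s + 2 * r + \<epsilon>"
      if "(a, b) \<in> R" "(a', b') \<in> R" "a \<in> A" "dX a a' < \<epsilon>" for a b a' b'
    proof -
      have "?mg b b' \<le> g b + dY b b'"
        using that mem by (intro Y.merge_fun_le_dist)
      also have "\<dots> \<le> s + 2 * r + \<epsilon>"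
        using dist[OF that(1,2)] fun_dist[OF that(1)] A(4)[OF that(3)] that(4) by linarith
      finally show ?thesis .
    qed
    \<comment> \<open>Quantifying over all partners of the current point lets the chain end in \<open>y'\<close> itself.\<close>
    have "\<forall>b. (x', b) \<in> R \<longrightarrow> ?mg y b \<le> s + 2 * r + \<epsilon>"
    proof (rule X.connectedin_chain_induct[where P = "\<lambda>a. \<forall>b. (a, b) \<in> R \<longrightarrow> ?mg y b \<le> s + 2 * r + \<epsilon>",
          OF A(1,2) _ A(3) \<open>\<epsilon> > 0\<close>])
      show "\<forall>b. (x, b) \<in> R \<longrightarrow> ?mg y b \<le> s + 2 * r + \<epsilon>"
        using near[OF xy(1) _ A(2)] mem xy \<open>\<epsilon> > 0\<close> by simp
    next
      fix a a' assume a: "a \<in> A" "a' \<in> A" "dX a a' < \<epsilon>"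
        and IH: "\<forall>b. (a, b) \<in> R \<longrightarrow> ?mg y b \<le> s + 2 * r + \<epsilon>"
      obtain b where b: "(a, b) \<in> R"
        using partner a AX by blast
      show "\<forall>b'. (a', b') \<in> R \<longrightarrow> ?mg y b' \<le> s + 2 * r + \<epsilon>"
      proof (intro allI impI)
        fix b' assume b': "(a', b') \<in> R"
        have "?mg y b' \<le> max (?mg y b) (?mg b b')"
          using mem xy b b' by (intro Y.merge_fun_ultra) auto
        also have "\<dots> \<le> s + 2 * r + \<epsilon>"
          using IH b near[OF b b' a(1,3)] by simp
        finally show "?mg y b' \<le> s + 2 * r + \<epsilon>" .
      qed
    qed
    then have "?mg y y' \<le> s + 2 * r + \<epsilon>"
      using xy(2) by blast
    then show ?thesis
      by (simp add: s_def \<epsilon>_def field_simps)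
  qed
  then show ?thesis
    by (rule field_le_epsilon)
qed

lemma correspondence_converse: "correspondence X Y R \<Longrightarrow> correspondence Y X (R\<inverse>)"
  by (auto simp: correspondence_def fst_eq_Domain snd_eq_Range)

text \<open>Twice the slack \<open>2 r\<close> of the merge functions, plus \<open>r\<close> for each of the two function values.\<close>

lemma merge_pdist_correspondence:
  assumes X: "lipschitz_geodesic X dX f" and Y: "lipschitz_geodesic Y dY g"
    and R: "correspondence X Y R"
    and dist: "\<And>x y x' y'. (x, y) \<in> R \<Longrightarrow> (x', y') \<in> R \<Longrightarrow> \<bar>dX x x' - dY y y'\<bar> \<le> r"
    and fun_dist: "\<And>x y. (x, y) \<in> R \<Longrightarrow> \<bar>f x - g y\<bar> \<le> r"
    and xy: "(x, y) \<in> R" "(x', y') \<in> R"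
  shows "\<bar>merge_pdist (Metric_space.mtopology X dX) f x x'
    - merge_pdist (Metric_space.mtopology Y dY) g y y'\<bar> \<le> 6 * r"
proof -
  have "merge_fun (Metric_space.mtopology Y dY) g y y'
      \<le> merge_fun (Metric_space.mtopology X dX) f x x' + 2 * r"
    by (rule merge_fun_correspondence_le[OF X Y R dist fun_dist xy])
  moreover have "merge_fun (Metric_space.mtopology X dX) f x x'
      \<le> merge_fun (Metric_space.mtopology Y dY) g y y' + 2 * r"
  proof (rule merge_fun_correspondence_le[OF Y X correspondence_converse[OF R]])
    show "\<bar>dY b b' - dX a a'\<bar> \<le> r" if "(b, a) \<in> R\<inverse>" "(b', a') \<in> R\<inverse>" for a a' b b'
      using dist[of a b a' b'] that by (simp add: abs_minus_commute)
    show "\<bar>g b - f a\<bar> \<le> r" if "(b, a) \<in> R\<inverse>" for a b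
      using fun_dist[of a b] that by (simp add: abs_minus_commute)
  qed (use xy in auto)
  ultimately show ?thesis
    using fun_dist[OF xy(1)] fun_dist[OF xy(2)] unfolding merge_pdist_def by linarith
qed

section \<open>Gromov--Hausdorff distances\<close>

lemma merge_tree_correspondence:
  assumes "lipschitz_geodesic X dX f" "lipschitz_geodesic Y dY g" and R: "correspondence X Y R"
  defines "TX \<equiv> Metric_space.mtopology X dX" and "TY \<equiv> Metric_space.mtopology Y dY"
  obtains R' where "correspondence (merge_tree TX f) (merge_tree TY g) R'"
    "distortion (merge_tree_dist TX f) (merge_tree_dist TY g) R' \<le> 6 * fun_distortion dX f dY g R"
proof -
  interpret X: lipschitz_geodesic X dX f by fact
  interpret Y: lipschitz_geodesic Y dY g by fact
  define R' where "R' = (\<lambda>(x, y). (X.merge_class x, Y.merge_class y)) ` R"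
  have "fst ` R' = X.merge_class ` fst ` R" "snd ` R' = Y.merge_class ` snd ` R"
    by (simp_all add: R'_def image_image case_prod_unfold)
  then have "fst ` R' = merge_tree TX f" "snd ` R' = merge_tree TY g"
    using R by (simp_all add: correspondence_def X.merge_tree_eq Y.merge_tree_eq TX_def TY_def)
  then have corr: "correspondence (merge_tree TX f) (merge_tree TY g) R'"
    unfolding correspondence_def using subset_fst_snd[of R'] by simp
  moreover have "distortion (merge_tree_dist TX f) (merge_tree_dist TY g) R'
      \<le> 6 * fun_distortion dX f dY g R"
  proof (cases "fun_distortion dX f dY g R")
    case top
    then show ?thesis
      by (simp add: ennreal_mult_top)
  next
    case (real r)
    have mem: "a \<in> X" "b \<in> Y" if "(a, b) \<in> R" for a b
      using R that by (auto simp: correspondence_def)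
    have "ennreal \<bar>dX x x' - dY y y'\<bar> \<le> ennreal r" if "(x, y) \<in> R" "(x', y') \<in> R" for x y x' y'
      unfolding real(2)[symmetric] fun_distortion_def distortion_def
      by (rule max.coboundedI1, rule SUP_upper2[where i = "((x, y), (x', y'))"]) (use that in auto)
    then have dist: "\<bar>dX x x' - dY y y'\<bar> \<le> r" if "(x, y) \<in> R" "(x', y') \<in> R" for x y x' y'
      using that real(1) by (simp add: ennreal_le_iff)
    have "ennreal \<bar>f x - g y\<bar> \<le> ennreal r" if "(x, y) \<in> R" for x y
      unfolding real(2)[symmetric] fun_distortion_def
      by (rule max.coboundedI2, rule SUP_upper2[where i = "(x, y)"]) (use that in auto)
    then have fun_dist: "\<bar>f x - g y\<bar> \<le> r" if "(x, y) \<in> R" for x y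
      using that real(1) by (simp add: ennreal_le_iff)
    have "\<bar>merge_tree_dist TX f (X.merge_class x) (X.merge_class x')
        - merge_tree_dist TY g (Y.merge_class y) (Y.merge_class y')\<bar> \<le> 6 * r"
      if "(x, y) \<in> R" "(x', y') \<in> R" for x y x' y'
      using merge_pdist_correspondence[OF assms(1,2) R dist fun_dist that] mem that
      by (simp add: TX_def TY_def X.merge_tree_dist_class Y.merge_tree_dist_class)
    then have "distortion (merge_tree_dist TX f) (merge_tree_dist TY g) R' \<le> ennreal (6 * r)"
      unfolding distortion_def R'_def by (intro SUP_least) (auto intro!: ennreal_leI)
    also have "\<dots> = 6 * fun_distortion dX f dY g R"
      using real by (simp add: ennreal_mult)
    finally show ?thesis .
  qed
  ultimately show thesis
    by (rule that)
qed

theorem theorem9: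
  fixes X :: "'a set" and dX :: "'a \<Rightarrow> 'a \<Rightarrow> real" and f :: "'a \<Rightarrow> real"
    and Y :: "'b set" and dY :: "'b \<Rightarrow> 'b \<Rightarrow> real" and g :: "'b \<Rightarrow> real"
  assumes "geodesic_space X dX" and "compact_space (Metric_space.mtopology X dX)"
    and "geodesic_space Y dY" and "compact_space (Metric_space.mtopology Y dY)"
    and "\<forall>x\<in>X. \<forall>x'\<in>X. \<bar>f x - f x'\<bar> \<le> dX x x'"
    and "\<forall>y\<in>Y. \<forall>y'\<in>Y. \<bar>g y - g y'\<bar> \<le> dY y y'"
  shows "GH_dist
      (merge_tree (Metric_space.mtopology X dX) f) (merge_tree_dist (Metric_space.mtopology X dX) f)
      (merge_tree (Metric_space.mtopology Y dY) g) (merge_tree_dist (Metric_space.mtopology Y dY) g)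
    \<le> 12 * GH_fun_dist X dX f Y dY g"
proof -
  let ?TX = "Metric_space.mtopology X dX" and ?TY = "Metric_space.mtopology Y dY"
  let ?I = "INF R\<in>{R. correspondence (merge_tree ?TX f) (merge_tree ?TY g) R}.
    distortion (merge_tree_dist ?TX f) (merge_tree_dist ?TY g) R"
  let ?J = "INF R\<in>{R. correspondence X Y R}. fun_distortion dX f dY g R"
  have X: "lipschitz_geodesic X dX f"
    using assms(1,2,5)
    by (simp add: lipschitz_geodesic_def lipschitz_geodesic_axioms_def geodesic_space_def)
  have Y: "lipschitz_geodesic Y dY g"
    using assms(3,4,6)
    by (simp add: lipschitz_geodesic_def lipschitz_geodesic_axioms_def geodesic_space_def)
  have "?I / 6 \<le> ?J"
  proof (rule INF_greatest)
    fix R assume "R \<in> {R. correspondence X Y R}"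
    then obtain R' where "correspondence (merge_tree ?TX f) (merge_tree ?TY g) R'"
      "distortion (merge_tree_dist ?TX f) (merge_tree_dist ?TY g) R' \<le> 6 * fun_distortion dX f dY g R"
      using merge_tree_correspondence[OF X Y] by blast
    then have "?I \<le> 6 * fun_distortion dX f dY g R"
      by (intro INF_lower2) auto
    then show "?I / 6 \<le> fun_distortion dX f dY g R"
      by (intro divide_le_posI_ennreal) auto
  qed
  then have "6 * (?I / 6) \<le> 12 * ?J"
    by (intro mult_mono) auto
  moreover have "6 * (?I / 6) = ?I"
    using mult_divide_eq_ennreal[of 6 ?I]
    by (simp only: ennreal_times_divide mult.commute[of 6 ?I]) simp
  ultimately have "?I \<le> 12 * ?J"
    by simp
  then have "?I / 2 \<le> 12 * ?J / 2"
    by (rule divide_right_mono_ennreal)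
  then show ?thesis
    by (simp add: GH_dist_def GH_fun_dist_def ennreal_times_divide)
qed

end
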